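(* Let $R$ be a characteristic range set and let $X$ be an ultrametrizable topological space. The following are equivalent: (1) $X$ is $\sigma$-locally compact; (2) for every $u\in\mathrm{UMet}_{\mathrm{bd}}(X;R)$, the space $X$ is an $F_\sigma$-subset of the completion of $(X,u)$. In particular, if $X$ is not $\sigma$-locally compact, there is $u\in\mathrm{UMet}_{\mathrm{bd}}(X;R)$ such that $X$ is not an $F_\sigma$-subset of the completion of $(X,u)$.
   Context: A range set is a subset $R\subseteq[0,\infty)$ with $0\in R$; it is characteristic if $\inf(R\setminus\{0\})=0$. An ultrametric on a set $X$ is a metric $d$ with $d(x,y)\leq \max\{d(x,z),d(z,y)\}$ for all $x,y,z$; it is $R$-valued if all its values lie in $R$. A topological space is ultrametrizable if its topology is generated by some ultrametric. For a topological space $X$, $\mathrm{UMet}_{\mathrm{bd}}(X;R)$ denotes the set of all bounded $R$-valued ultrametrics on $X$ that generate the topology of $X$. A space is $\sigma$-locally compact if it is a countable union of locally compact subspaces. The completion is the metric completion, with $X$ regarded as a (dense) subset of it. *)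

theory Defs
  imports "HOL-Analysis.Analysis"
begin

section \<open>Range sets and spaces of ultrametrics\<close>

definition range_set :: "real set \<Rightarrow> bool" where
  "range_set R \<longleftrightarrow> R \<subseteq> {0..} \<and> 0 \<in> R"

text \<open>The non-emptiness conjunct renders the convention that the infimum of the empty set is
  infinite; \<^const>\<open>Inf\<close> of the empty set of reals is unspecified.\<close>

definition characteristic :: "real set \<Rightarrow> bool" where
  "characteristic R \<longleftrightarrow> R - {0} \<noteq> {} \<and> Inf (R - {0}) = 0"

definition ultrametric :: "'a metric \<Rightarrow> bool" where
  "ultrametric m \<longleftrightarrow>
     (\<forall>x\<in>mspace m. \<forall>y\<in>mspace m. \<forall>z\<in>mspace m. mdist m x y \<le> max (mdist m x z) (mdist m z y))"

definition valued_in :: "'a metric \<Rightarrow> real set \<Rightarrow> bool" where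
  "valued_in m R \<longleftrightarrow> (\<forall>x\<in>mspace m. \<forall>y\<in>mspace m. mdist m x y \<in> R)"

definition bounded_metric :: "'a metric \<Rightarrow> bool" where
  "bounded_metric m \<longleftrightarrow> Metric_space.mbounded (mspace m) (mdist m) (mspace m)"

definition ultrametrizable_space :: "'a topology \<Rightarrow> bool" where
  "ultrametrizable_space X \<longleftrightarrow> (\<exists>m. ultrametric m \<and> mtopology_of m = X)"

text \<open>The underlying set of a member is automatically \<^term>\<open>topspace X\<close>.  Metrics that
  differ only in their irrelevant values outside \<^term>\<open>topspace X\<close> are not identified.\<close>

definition UMet_bd :: "'a topology \<Rightarrow> real set \<Rightarrow> 'a metric set" where
  "UMet_bd X R =
     {m. ultrametric m \<and> valued_in m R \<and> bounded_metric m \<and> mtopology_of m = X}"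

text \<open>The pieces are arbitrary subspaces, not required to be open or closed.\<close>

definition sigma_locally_compact_space :: "'a topology \<Rightarrow> bool" where
  "sigma_locally_compact_space X \<longleftrightarrow>
     (\<exists>\<C>. countable \<C> \<and> (\<forall>S\<in>\<C>. S \<subseteq> topspace X \<and> locally_compact_space (subtopology X S))
          \<and> \<Union>\<C> = topspace X)"


section \<open>The completion of a metric space\<close>

text \<open>The usual construction: Cauchy sequences modulo distance tending to zero, with the
  limit distance.  Points of the space correspond to classes of constant sequences.\<close>

definition cauchy_rel :: "'a metric \<Rightarrow> ((nat \<Rightarrow> 'a) \<times> (nat \<Rightarrow> 'a)) set" where
  "cauchy_rel m =
     {(\<sigma>, \<tau>). Metric_space.MCauchy (mspace m) (mdist m) \<sigma> \<and>
              Metric_space.MCauchy (mspace m) (mdist m) \<tau> \<and>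
              (\<lambda>n. mdist m (\<sigma> n) (\<tau> n)) \<longlonglongrightarrow> 0}"

definition completion_space :: "'a metric \<Rightarrow> (nat \<Rightarrow> 'a) set set" where
  "completion_space m = Collect (Metric_space.MCauchy (mspace m) (mdist m)) // cauchy_rel m"

text \<open>The value outside \<^term>\<open>completion_space m\<close> is irrelevant; it is fixed because the
  library's metric spaces have a globally nonnegative and symmetric distance.\<close>

definition completion_dist :: "'a metric \<Rightarrow> (nat \<Rightarrow> 'a) set \<Rightarrow> (nat \<Rightarrow> 'a) set \<Rightarrow> real" where
  "completion_dist m P Q =
     (if P \<in> completion_space m \<and> Q \<in> completion_space m
      then lim (\<lambda>n. mdist m ((SOME \<sigma>. \<sigma> \<in> P) n) ((SOME \<tau>. \<tau> \<in> Q) n)) else 0)"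

definition completion_metric :: "'a metric \<Rightarrow> (nat \<Rightarrow> 'a) set metric" where
  "completion_metric m = metric (completion_space m, completion_dist m)"

definition completion_embed :: "'a metric \<Rightarrow> 'a \<Rightarrow> (nat \<Rightarrow> 'a) set" where
  "completion_embed m x = cauchy_rel m `` {\<lambda>_. x}"

abbreviation cauchy_in :: "'a metric \<Rightarrow> (nat \<Rightarrow> 'a) \<Rightarrow> bool" where
  "cauchy_in m \<equiv> Metric_space.MCauchy (mspace m) (mdist m)"

lemma cauchy_in_def:
  "cauchy_in m \<sigma> \<longleftrightarrow> range \<sigma> \<subseteq> mspace m \<and>
     (\<forall>\<epsilon>>0. \<exists>N. \<forall>n n'. N \<le> n \<longrightarrow> N \<le> n' \<longrightarrow> mdist m (\<sigma> n) (\<sigma> n') < \<epsilon>)"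
  by (simp add: Metric_space.MCauchy_def)

lemma cauchy_in_mem: "cauchy_in m \<sigma> \<Longrightarrow> \<sigma> n \<in> mspace m"
  by (auto simp: cauchy_in_def)

lemma mdist_self: "x \<in> mspace m \<Longrightarrow> mdist m x x = 0"
  by simp

lemma cauchy_in_const: "x \<in> mspace m \<Longrightarrow> cauchy_in m (\<lambda>_. x)"
  by (auto simp: cauchy_in_def mdist_self)

lemma mdist_quad:
  assumes "x \<in> mspace m" "y \<in> mspace m" "x' \<in> mspace m" "y' \<in> mspace m"
  shows "\<bar>mdist m x y - mdist m x' y'\<bar> \<le> mdist m x x' + mdist m y y'"
  using mdist_triangle[of x m x' y] mdist_triangle[of x' m y' y]
    mdist_triangle[of x' m x y'] mdist_triangle[of x m y y'] assms
    mdist_commute[of m x x'] mdist_commute[of m y y'] by linarith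

lemma convergent_cauchy_dist:
  assumes "cauchy_in m \<sigma>" "cauchy_in m \<tau>"
  shows "convergent (\<lambda>n. mdist m (\<sigma> n) (\<tau> n))"
proof -
  have "Cauchy (\<lambda>n. mdist m (\<sigma> n) (\<tau> n))"
  proof (rule metric_CauchyI)
    fix e :: real assume "e > 0"
    then have "e/2 > 0" by simp
    obtain N1 where N1: "\<And>n n'. N1 \<le> n \<Longrightarrow> N1 \<le> n' \<Longrightarrow> mdist m (\<sigma> n) (\<sigma> n') < e/2"
      using assms(1) \<open>e/2 > 0\<close> unfolding cauchy_in_def by meson
    obtain N2 where N2: "\<And>n n'. N2 \<le> n \<Longrightarrow> N2 \<le> n' \<Longrightarrow> mdist m (\<tau> n) (\<tau> n') < e/2"
      using assms(2) \<open>e/2 > 0\<close> unfolding cauchy_in_def by meson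
    have "dist (mdist m (\<sigma> k) (\<tau> k)) (mdist m (\<sigma> n) (\<tau> n)) < e"
      if "max N1 N2 \<le> k" "max N1 N2 \<le> n" for k n
      using mdist_quad[of "\<sigma> k" m "\<tau> k" "\<sigma> n" "\<tau> n"] N1[of k n] N2[of k n] that
        cauchy_in_mem[OF assms(1)] cauchy_in_mem[OF assms(2)]
      by (simp add: dist_real_def)
    then show "\<exists>M. \<forall>k\<ge>M. \<forall>n\<ge>M. dist (mdist m (\<sigma> k) (\<tau> k)) (mdist m (\<sigma> n) (\<tau> n)) < e"
      by blast
  qed
  then show ?thesis by (rule Cauchy_convergent)
qed

lemma equiv_cauchy_rel: "equiv (Collect (cauchy_in m)) (cauchy_rel m)"
proof (rule equivI)
  show "cauchy_rel m \<subseteq> Collect (cauchy_in m) \<times> Collect (cauchy_in m)"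
    by (auto simp: cauchy_rel_def)
  show "refl_on (Collect (cauchy_in m)) (cauchy_rel m)"
    by (auto simp: refl_on_def cauchy_rel_def cauchy_in_mem mdist_self)
  show "sym (cauchy_rel m)"
    by (auto simp: sym_def cauchy_rel_def mdist_commute)
  show "trans (cauchy_rel m)"
  proof (rule transI)
    fix a b c assume "(a, b) \<in> cauchy_rel m" "(b, c) \<in> cauchy_rel m"
    then have C: "cauchy_in m a" "cauchy_in m b" "cauchy_in m c"
      and L: "(\<lambda>n. mdist m (a n) (b n)) \<longlonglongrightarrow> 0" "(\<lambda>n. mdist m (b n) (c n)) \<longlonglongrightarrow> 0"
      by (auto simp: cauchy_rel_def)
    have "(\<lambda>n. mdist m (a n) (c n)) \<longlonglongrightarrow> 0"
    proof (rule Lim_null_comparison[OF always_eventually])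
      show "\<forall>n. norm (mdist m (a n) (c n)) \<le> mdist m (a n) (b n) + mdist m (b n) (c n)"
        using C by (auto intro!: mdist_triangle simp: cauchy_in_mem)
      show "(\<lambda>n. mdist m (a n) (b n) + mdist m (b n) (c n)) \<longlonglongrightarrow> 0"
        using tendsto_add[OF L] by simp
    qed
    then show "(a, c) \<in> cauchy_rel m" using C by (simp add: cauchy_rel_def)
  qed
qed

lemma completion_class: "cauchy_in m \<sigma> \<Longrightarrow> cauchy_rel m `` {\<sigma>} \<in> completion_space m"
  by (simp add: completion_space_def quotientI)

lemma completion_space_cases:
  assumes "P \<in> completion_space m"
  obtains \<sigma> where "cauchy_in m \<sigma>" "P = cauchy_rel m `` {\<sigma>}"
  using assms by (auto simp: completion_space_def elim!: quotientE)

lemma completion_dist_tendsto: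
  assumes "cauchy_in m \<sigma>" "cauchy_in m \<tau>"
  shows "(\<lambda>n. mdist m (\<sigma> n) (\<tau> n)) \<longlonglongrightarrow>
           completion_dist m (cauchy_rel m `` {\<sigma>}) (cauchy_rel m `` {\<tau>})"
proof -
  define s where "s = (SOME \<sigma>'. \<sigma>' \<in> cauchy_rel m `` {\<sigma>})"
  define t where "t = (SOME \<tau>'. \<tau>' \<in> cauchy_rel m `` {\<tau>})"
  have "s \<in> cauchy_rel m `` {\<sigma>}" "t \<in> cauchy_rel m `` {\<tau>}"
    unfolding s_def t_def
    using equiv_class_self[OF equiv_cauchy_rel] assms by (metis mem_Collect_eq someI_ex)+
  then have st: "cauchy_in m s" "cauchy_in m t"
    and L: "(\<lambda>n. mdist m (\<sigma> n) (s n)) \<longlonglongrightarrow> 0" "(\<lambda>n. mdist m (\<tau> n) (t n)) \<longlonglongrightarrow> 0"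
    by (auto simp: cauchy_rel_def)
  have 1: "(\<lambda>n. mdist m (s n) (t n)) \<longlonglongrightarrow>
           completion_dist m (cauchy_rel m `` {\<sigma>}) (cauchy_rel m `` {\<tau>})"
    using convergent_cauchy_dist[OF st] completion_class[OF assms(1)] completion_class[OF assms(2)]
    unfolding completion_dist_def s_def[symmetric] t_def[symmetric] convergent_LIMSEQ_iff by simp
  have 2: "(\<lambda>n. mdist m (\<sigma> n) (s n) + mdist m (\<tau> n) (t n)) \<longlonglongrightarrow> 0"
    using tendsto_add[OF L] by simp
  have "(\<lambda>n. mdist m (\<sigma> n) (\<tau> n) - mdist m (s n) (t n)) \<longlonglongrightarrow> 0"
    by (rule Lim_null_comparison[OF _ 2])
      (auto intro!: always_eventually mdist_quad simp: assms st cauchy_in_mem)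
  from tendsto_add[OF this 1] show ?thesis by simp
qed

lemma Metric_space_completion: "Metric_space (completion_space m) (completion_dist m)"
proof
  fix P Q
  show "0 \<le> completion_dist m P Q"
  proof (cases "P \<in> completion_space m \<and> Q \<in> completion_space m")
    case True
    then obtain \<sigma> \<tau> where "cauchy_in m \<sigma>" "P = cauchy_rel m `` {\<sigma>}"
      "cauchy_in m \<tau>" "Q = cauchy_rel m `` {\<tau>}"
      by (meson completion_space_cases)
    then show ?thesis
      using LIMSEQ_le_const[OF completion_dist_tendsto[of m \<sigma> \<tau>], of 0] by auto
  qed (auto simp: completion_dist_def)
  show "completion_dist m P Q = completion_dist m Q P"
    by (auto simp: completion_dist_def mdist_commute)
next
  fix P Q assume "P \<in> completion_space m" "Q \<in> completion_space m"
  then obtain \<sigma> \<tau> where *: "cauchy_in m \<sigma>" "P = cauchy_rel m `` {\<sigma>}"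
    "cauchy_in m \<tau>" "Q = cauchy_rel m `` {\<tau>}"
    by (meson completion_space_cases)
  have "completion_dist m P Q = 0 \<longleftrightarrow> (\<lambda>n. mdist m (\<sigma> n) (\<tau> n)) \<longlonglongrightarrow> 0"
    using completion_dist_tendsto[of m \<sigma> \<tau>] * LIMSEQ_unique by metis
  also have "\<dots> \<longleftrightarrow> (\<sigma>, \<tau>) \<in> cauchy_rel m" using * by (simp add: cauchy_rel_def)
  also have "\<dots> \<longleftrightarrow> P = Q"
    using eq_equiv_class_iff[OF equiv_cauchy_rel, of \<sigma> m \<tau>] * by simp
  finally show "completion_dist m P Q = 0 \<longleftrightarrow> P = Q" .
next
  fix P Q S
  assume "P \<in> completion_space m" "Q \<in> completion_space m" "S \<in> completion_space m"
  then obtain \<sigma> \<tau> \<upsilon> where *: "cauchy_in m \<sigma>" "P = cauchy_rel m `` {\<sigma>}"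
    "cauchy_in m \<tau>" "Q = cauchy_rel m `` {\<tau>}" "cauchy_in m \<upsilon>" "S = cauchy_rel m `` {\<upsilon>}"
    by (meson completion_space_cases)
  show "completion_dist m P S \<le> completion_dist m P Q + completion_dist m Q S"
    unfolding *
    by (rule LIMSEQ_le[OF completion_dist_tendsto
          tendsto_add[OF completion_dist_tendsto completion_dist_tendsto]])
      (auto simp: * cauchy_in_mem intro!: mdist_triangle)
qed

lemma mspace_completion_metric [simp]: "mspace (completion_metric m) = completion_space m"
  by (simp add: completion_metric_def Metric_space.mspace_metric Metric_space_completion)

lemma mdist_completion_metric [simp]: "mdist (completion_metric m) = completion_dist m"
  by (simp add: completion_metric_def Metric_space.mdist_metric Metric_space_completion)

lemma completion_embed_mem: "completion_embed m \<in> mspace m \<rightarrow> mspace (completion_metric m)"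
  by (auto simp: completion_embed_def completion_class cauchy_in_const)

lemma completion_embed_isometry:
  assumes "x \<in> mspace m" "y \<in> mspace m"
  shows "mdist (completion_metric m) (completion_embed m x) (completion_embed m y) = mdist m x y"
  using completion_dist_tendsto[OF cauchy_in_const[OF assms(1)] cauchy_in_const[OF assms(2)]]
  by (simp add: completion_embed_def LIMSEQ_const_iff)

text \<open>A Cauchy sequence of points converges, in the completion, to its own class.\<close>

lemma completion_embed_tendsto:
  assumes "cauchy_in m \<sigma>"
  shows "(\<lambda>n. completion_dist m (completion_embed m (\<sigma> n)) (cauchy_rel m `` {\<sigma>})) \<longlonglongrightarrow> 0"
proof (rule LIMSEQ_I)
  fix e :: real assume "e > 0"
  then have "e/2 > 0" by simp
  then obtain N where N: "\<And>n n'. N \<le> n \<Longrightarrow> N \<le> n' \<Longrightarrow> mdist m (\<sigma> n) (\<sigma> n') < e/2"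
    using assms unfolding cauchy_in_def by meson
  have "norm (completion_dist m (completion_embed m (\<sigma> n)) (cauchy_rel m `` {\<sigma>}) - 0) < e"
    if "N \<le> n" for n
  proof -
    have "completion_dist m (completion_embed m (\<sigma> n)) (cauchy_rel m `` {\<sigma>}) \<le> e/2"
      unfolding completion_embed_def
      by (rule LIMSEQ_le_const2[OF completion_dist_tendsto])
        (use assms that N in \<open>auto simp: cauchy_in_mem cauchy_in_const intro!: exI[of _ N] less_imp_le\<close>)
    then show ?thesis
      using \<open>e > 0\<close> Metric_space.nonneg[OF Metric_space_completion, of m] by simp
  qed
  then show "\<exists>no. \<forall>n\<ge>no.
      norm (completion_dist m (completion_embed m (\<sigma> n)) (cauchy_rel m `` {\<sigma>}) - 0) < e"
    by blast
qed

lemma completion_embed_approx: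
  assumes "P \<in> completion_space m" "e > 0"
  obtains x where "x \<in> mspace m" "completion_dist m (completion_embed m x) P < e"
proof -
  obtain \<sigma> where \<sigma>: "cauchy_in m \<sigma>" "P = cauchy_rel m `` {\<sigma>}"
    using assms completion_space_cases by metis
  then have "eventually (\<lambda>n. completion_dist m (completion_embed m (\<sigma> n)) P < e) sequentially"
    using order_tendstoD(2)[OF completion_embed_tendsto \<open>e > 0\<close>] by simp
  then show thesis
    using that cauchy_in_mem[OF \<sigma>(1)] eventually_happens' sequentially_bot by blast
qed

lemma completion_embed_dense:
  "mtopology_of (completion_metric m) closure_of completion_embed m ` mspace m
     = mspace (completion_metric m)"
proof -
  interpret C: Metric_space "completion_space m" "completion_dist m"
    by (rule Metric_space_completion)
  have "P \<in> C.mtopology closure_of completion_embed m ` mspace m" if "P \<in> completion_space m" for P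
    unfolding C.metric_closure_of using that completion_embed_mem[of m]
    by (auto simp: C.commute[of P] elim!: completion_embed_approx)
  then show ?thesis
    using closure_of_subset_topspace by (fastforce simp: mtopology_of_def)
qed

lemma completion_mcomplete: "mcomplete_of (completion_metric m)"
proof -
  interpret C: Metric_space "completion_space m" "completion_dist m"
    by (rule Metric_space_completion)
  have "\<exists>Q. limitin C.mtopology P Q sequentially" if P: "C.MCauchy P" for P
  proof -
    have Pm: "P n \<in> completion_space m" for n
      using P by (auto simp: C.MCauchy_def)
    have "\<exists>x\<in>mspace m. completion_dist m (completion_embed m x) (P n) < inverse (Suc n)" for n
      using completion_embed_approx[OF Pm, of "inverse (Suc n)" n] by (metis inverse_positive_iff_positive of_nat_0_less_iff zero_less_Suc)
    then obtain x where x: "\<And>n. x n \<in> mspace m"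
      "\<And>n. completion_dist m (completion_embed m (x n)) (P n) < inverse (Suc n)"
      by metis
    have E: "completion_embed m (x n) \<in> completion_space m" for n
      using completion_embed_mem[of m] x(1)[of n] by (simp add: Pi_iff)
    have lim0: "(\<lambda>n. completion_dist m (completion_embed m (x n)) (P n)) \<longlonglongrightarrow> 0"
    proof (rule Lim_null_comparison[OF always_eventually LIMSEQ_inverse_real_of_nat])
      show "\<forall>n. norm (completion_dist m (completion_embed m (x n)) (P n)) \<le> inverse (real (Suc n))"
        using x(2) less_imp_le by auto
    qed
    have xC: "cauchy_in m x"
      unfolding cauchy_in_def
    proof (intro conjI allI impI)
      show "range x \<subseteq> mspace m" using x by auto
      fix e :: real assume "e > 0"
      then have e3: "e/3 > 0" by simp
      obtain N1 where N1: "\<And>n n'. N1 \<le> n \<Longrightarrow> N1 \<le> n' \<Longrightarrow> completion_dist m (P n) (P n') < e/3"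
        using P e3 unfolding C.MCauchy_def by meson
      obtain N2 where N2:
        "\<And>n. N2 \<le> n \<Longrightarrow> completion_dist m (completion_embed m (x n)) (P n) < e/3"
        using order_tendstoD(2)[OF lim0 e3] unfolding eventually_sequentially by blast
      have "mdist m (x n) (x n') < e" if "max N1 N2 \<le> n" "max N1 N2 \<le> n'" for n n'
      proof -
        have "mdist m (x n) (x n') = completion_dist m (completion_embed m (x n)) (completion_embed m (x n'))"
          using completion_embed_isometry[OF x(1) x(1)] by simp
        also have "\<dots> \<le> completion_dist m (completion_embed m (x n)) (P n)
            + (completion_dist m (P n) (P n') + completion_dist m (P n') (completion_embed m (x n')))"
          using C.triangle[OF E[of n] Pm[of n] E[of n']] C.triangle[OF Pm[of n] Pm[of n'] E[of n']]
          by linarith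
        also have "\<dots> < e"
          using N1[of n n'] N2[of n] N2[of n'] that C.commute[of "P n'"] by simp
        finally show ?thesis .
      qed
      then show "\<exists>N. \<forall>n n'. N \<le> n \<longrightarrow> N \<le> n' \<longrightarrow> mdist m (x n) (x n') < e" by blast
    qed
    define Q where "Q = cauchy_rel m `` {x}"
    have Q: "Q \<in> completion_space m" by (simp add: Q_def completion_class xC)
    have "(\<lambda>n. completion_dist m (P n) Q) \<longlonglongrightarrow> 0"
    proof (rule tendsto_sandwich[OF _ _ tendsto_const])
      show "(\<lambda>n. completion_dist m (completion_embed m (x n)) (P n)
          + completion_dist m (completion_embed m (x n)) Q) \<longlonglongrightarrow> 0"
        using tendsto_add[OF lim0 completion_embed_tendsto[OF xC]] by (simp add: Q_def)
      show "\<forall>\<^sub>F n in sequentially. completion_dist m (P n) Q \<le>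
          completion_dist m (completion_embed m (x n)) (P n)
          + completion_dist m (completion_embed m (x n)) Q"
        using C.triangle[OF Pm E Q] C.commute by (auto intro!: always_eventually)
    qed auto
    then show ?thesis
      using Q Pm by (auto simp: C.limitin_metric_dist_null)
  qed
  then have "C.mcomplete" by (simp add: C.mcomplete_def)
  then show ?thesis by (simp add: mcomplete_of_def)
qed

end

theory Submission
  imports Defs
begin

text \<open>
  Locally compact subspaces of a metrizable space are intersections of an open and a closed set,
  hence F-sigma; this gives one direction.  For the other one, let \<open>X\<close> be ultrametrizable but not
  sigma-locally compact, and take any \<open>R\<close>-valued ultrametric \<open>d\<close> on \<open>X\<close>.  If \<open>X\<close> is F-sigma in its
  \<open>d\<close>-completion, then \<open>X\<close> is a countable union of \<open>d\<close>-complete closed sets, one of which is not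
  sigma-locally compact.  Removing from it all balls that are sigma-locally compact leaves a
  nonempty \<open>d\<close>-complete set \<open>Z\<close> no ball of which is compact, so every ball of \<open>Z\<close> contains a
  ball with infinitely many children.  Now coarsen \<open>d\<close> to an ultrametric \<open>u\<close> with the same topology
  by separating, in every ball of \<open>X\<close>, the children that meet \<open>Z\<close> one after the other instead of
  simultaneously.  This creates \<open>u\<close>-Cauchy sequences without limit in every ball of \<open>Z\<close>, whereas
  if \<open>X\<close> were F-sigma in its \<open>u\<close>-completion, then by the Baire category theorem some
  \<open>u\<close>-complete set would contain a ball of \<open>Z\<close>.
\<close>

section \<open>Sigma-local compactness of subspaces\<close>

text \<open>A set open in \<open>L \<inter> U\<close> is open in \<open>L\<close> because
  \<open>U\<close> is open, and compactness does not depend on the ambient subspace. This later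
  glues pieces that lie in disjoint open sets.\<close>

lemma locally_compact_space_local:
  assumes "\<And>x. x \<in> topspace X \<inter> L \<Longrightarrow>
    \<exists>U. openin X U \<and> x \<in> U \<and> locally_compact_space (subtopology X (L \<inter> U))"
  shows "locally_compact_space (subtopology X L)"
  unfolding locally_compact_space_def
proof
  fix x assume "x \<in> topspace (subtopology X L)"
  then have x: "x \<in> topspace X \<inter> L" by simp
  then obtain U where U: "openin X U" "x \<in> U" "locally_compact_space (subtopology X (L \<inter> U))"
    using assms by blast
  obtain V K where V: "openin (subtopology X (L \<inter> U)) V" "compactin (subtopology X (L \<inter> U)) K"
    "x \<in> V" "V \<subseteq> K"
    using U(2,3) x unfolding locally_compact_space_def topspace_subtopology
    by (metis IntD1 IntD2 IntI)
  obtain W where W: "openin X W" "V = W \<inter> (L \<inter> U)"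
    using V(1) by (auto simp: openin_subtopology)
  have "V = (W \<inter> U) \<inter> L" using W by auto
  then have "openin (subtopology X L) V"
    using W(1) U(1) by (metis openin_Int openin_subtopology)
  moreover have "compactin (subtopology X L) K"
    using V(2) by (simp add: compactin_subtopology)
  ultimately show "\<exists>V K. openin (subtopology X L) V \<and> compactin (subtopology X L) K \<and> x \<in> V \<and> V \<subseteq> K"
    using V by blast
qed

text \<open>The pieces are numbered by \<open>nat\<close>, so that families living on disjoint open
  sets can be united number by number.\<close>

definition sigma_locally_compact_in :: "'a topology \<Rightarrow> 'a set \<Rightarrow> bool" where
  "sigma_locally_compact_in X S \<longleftrightarrow>
     (\<exists>L. (\<Union>n::nat. L n) = S \<and> (\<forall>n. locally_compact_space (subtopology X (L n))))"

lemma sigma_locally_compact_in_imp_space: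
  assumes "sigma_locally_compact_in X (topspace X)"
  shows "sigma_locally_compact_space X"
proof -
  obtain L where "(\<Union>n::nat. L n) = topspace X" "\<And>n. locally_compact_space (subtopology X (L n))"
    using assms unfolding sigma_locally_compact_in_def by auto
  then show ?thesis
    unfolding sigma_locally_compact_space_def by (intro exI[of _ "range L"]) auto
qed

lemma sigma_locally_compact_in_UN:
  assumes "\<And>n::nat. sigma_locally_compact_in X (S n)"
  shows "sigma_locally_compact_in X (\<Union>n. S n)"
proof -
  obtain L where L: "\<And>n. (\<Union>k::nat. L n k) = S n"
    "\<And>n k. locally_compact_space (subtopology X (L n k))"
    using assms unfolding sigma_locally_compact_in_def by metis
  have "(\<Union>i. (\<lambda>(n, k). L n k) (prod_decode i)) = (\<Union>p. (\<lambda>(n, k). L n k) p)"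
    by (metis (no_types) image_image surj_prod_decode)
  also have "\<dots> = (\<Union>n. \<Union>k. L n k)" by auto
  also have "\<dots> = (\<Union>n. S n)" by (simp only: L(1))
  finally show ?thesis
    using L(2) unfolding sigma_locally_compact_in_def
    by (intro exI[of _ "\<lambda>i. (\<lambda>(n, k). L n k) (prod_decode i)"]) (auto split: prod.split)
qed

lemma sigma_locally_compact_in_Un:
  assumes "sigma_locally_compact_in X S" "sigma_locally_compact_in X T"
  shows "sigma_locally_compact_in X (S \<union> T)"
proof -
  have "(\<Union>n::nat. if n = 0 then S else T) = S \<union> T"
    by (auto split: if_splits intro: exI[of _ 0] exI[of _ 1])
  then show ?thesis
    using sigma_locally_compact_in_UN[of X "\<lambda>n. if n = 0 then S else T"] assms by simp
qed

text \<open>Local compactness passes to open subspaces of Hausdorff spaces, so every piece can be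
  cut with \<open>U\<close>.\<close>

lemma sigma_locally_compact_in_Int_openin:
  assumes "Hausdorff_space X" "sigma_locally_compact_in X S" "openin X U"
  shows "sigma_locally_compact_in X (S \<inter> U)"
proof -
  obtain L where L: "(\<Union>n::nat. L n) = S" "\<And>n. locally_compact_space (subtopology X (L n))"
    using assms(2) unfolding sigma_locally_compact_in_def by auto
  have "locally_compact_space (subtopology X (L n \<inter> U))" for n
  proof -
    have "locally_compact_space (subtopology (subtopology X (L n)) (L n \<inter> U))"
      using assms L(2)[of n] openin_subtopology_Int2[of X U "L n"]
      by (intro locally_compact_space_open_subset[where X = "subtopology X (L n)"])
        (auto simp: Hausdorff_space_subtopology)
    then show ?thesis by (simp add: subtopology_subtopology inf_assoc[symmetric])
  qed
  then show ?thesis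
    using L(1) unfolding sigma_locally_compact_in_def by (intro exI[of _ "\<lambda>n. L n \<inter> U"]) auto
qed

lemma compactin_imp_sigma_locally_compact_in:
  "compactin X S \<Longrightarrow> sigma_locally_compact_in X S"
  unfolding sigma_locally_compact_in_def
  by (intro exI[of _ "\<lambda>_. S"]) (auto simp: compact_imp_locally_compact_space compact_space_subtopology)


section \<open>Sigma-locally compact spaces are F-sigma in their completions\<close>

lemma locally_compact_subspace_imp_fsigma_in:
  assumes "metrizable_space X" "S \<subseteq> topspace X" "locally_compact_space (subtopology X S)"
  shows "fsigma_in X S"
proof -
  obtain T where "openin X T" "S = T \<inter> X closure_of S"
    using locally_compact_subspace_openin_closure_of[OF metrizable_imp_Hausdorff_space, OF assms]
    by (auto simp: openin_subtopology)
  then show ?thesis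
    using assms(1) by (metis fsigma_in_Int open_imp_fsigma_in closed_imp_fsigma_in closedin_closure_of)
qed

lemma embedding_map_completion_embed:
  "embedding_map (mtopology_of m) (mtopology_of (completion_metric m)) (completion_embed m)"
proof -
  interpret Metric_space12 "mspace m" "mdist m" "completion_space m" "completion_dist m"
    by (simp add: Metric_space12_def Metric_space_completion)
  show ?thesis
    using isometry_imp_embedding_map[of "completion_embed m"] completion_embed_mem[of m]
      completion_embed_isometry[of _ m]
    by (simp add: mtopology_of_def)
qed

text \<open>Local compactness is intrinsic, so the pieces keep it when the isometric embedding
  carries them into the completion, where each becomes F-sigma.\<close>

lemma sigma_locally_compact_space_imp_fsigma_in_completion:
  assumes "sigma_locally_compact_space (mtopology_of m)"
  shows "fsigma_in (mtopology_of (completion_metric m)) (completion_embed m ` mspace m)"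
proof -
  let ?X = "mtopology_of m" and ?Y = "mtopology_of (completion_metric m)" and ?e = "completion_embed m"
  obtain \<C> where \<C>: "countable \<C>" "\<Union>\<C> = mspace m"
    "\<And>S. S \<in> \<C> \<Longrightarrow> S \<subseteq> mspace m \<and> locally_compact_space (subtopology ?X S)"
    using assms unfolding sigma_locally_compact_space_def by auto
  have hom: "homeomorphic_map ?X (subtopology ?Y (?e ` mspace m)) ?e"
    using embedding_map_completion_embed[of m] by (simp add: embedding_map_def)
  have met: "metrizable_space ?Y"
    by (simp add: mtopology_of_def Metric_space.metrizable_space_mtopology Metric_space_completion)
  have "fsigma_in ?Y (?e ` S)" if "S \<in> \<C>" for S
  proof (rule locally_compact_subspace_imp_fsigma_in[OF met])
    have S: "S \<subseteq> mspace m" using \<C>(3) that by auto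
    show sub: "?e ` S \<subseteq> topspace ?Y" using S completion_embed_mem[of m] by auto
    have "homeomorphic_map (subtopology ?X S) (subtopology (subtopology ?Y (?e ` mspace m)) (?e ` S)) ?e"
      by (rule homeomorphic_map_subtopologies[OF hom]) (use S sub in auto)
    then have "homeomorphic_map (subtopology ?X S) (subtopology ?Y (?e ` S)) ?e"
      using S by (simp add: subtopology_subtopology Int_absorb1 image_mono)
    then show "locally_compact_space (subtopology ?Y (?e ` S))"
      using \<C>(3)[OF that] homeomorphic_locally_compact_spaceD homeomorphic_map_imp_homeomorphic_space
      by blast
  qed
  then have "fsigma_in ?Y (\<Union>((`) ?e ` \<C>))"
    using \<C>(1) by (intro fsigma_in_Union) auto
  moreover have "\<Union>((`) ?e ` \<C>) = ?e ` mspace m" using \<C>(2) by auto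
  ultimately show ?thesis by simp
qed


section \<open>Towers of clopen partitions\<close>

text \<open>\<open>E n x y\<close> says that \<open>x\<close> and \<open>y\<close> lie in the same class of the \<open>n\<close>-th partition; \<open>r n\<close> is
  the distance assigned to points that are separated at level \<open>n\<close> for the first time.\<close>

locale clopen_tower =
  fixes X :: "'a topology" and E :: "nat \<Rightarrow> 'a \<Rightarrow> 'a \<Rightarrow> bool" and r :: "nat \<Rightarrow> real"
  assumes topspace: "E n x y \<Longrightarrow> x \<in> topspace X"
    and refl: "x \<in> topspace X \<Longrightarrow> E n x x"
    and sym: "E n x y \<Longrightarrow> E n y x"
    and trans: "E n x y \<Longrightarrow> E n y z \<Longrightarrow> E n x z"
    and anti_Suc: "E (Suc n) x y \<Longrightarrow> E n x y"
    and openin_class: "openin X {y. E n x y}"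
    and basis: "openin X U \<Longrightarrow> x \<in> U \<Longrightarrow> \<exists>n. {y. E n x y} \<subseteq> U"
    and separated: "x \<in> topspace X \<Longrightarrow> (\<And>n. E n x y) \<Longrightarrow> x = y"
    and r_pos: "0 < r n"
    and r_dec: "r (Suc n) < r n"
    and r_lim: "r \<longlonglongrightarrow> 0"
begin

definition cls :: "nat \<Rightarrow> 'a \<Rightarrow> 'a set" where
  "cls n x = {y. E n x y}"

lemma mem_cls [simp]: "y \<in> cls n x \<longleftrightarrow> E n x y"
  by (simp add: cls_def)

lemma openin_cls: "openin X (cls n x)"
  using openin_class by (simp add: cls_def)

lemma topspace': "E n x y \<Longrightarrow> y \<in> topspace X"
  using sym topspace by blast

lemma cls_eq_iff: "x \<in> topspace X \<Longrightarrow> cls n x = cls n y \<longleftrightarrow> E n x y"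
proof
  show "E n x y" if "x \<in> topspace X" "cls n x = cls n y"
    using refl[OF that(1)] that(2) sym by (metis mem_cls)
  show "cls n x = cls n y" if "E n x y"
    using that sym trans unfolding cls_def by blast
qed

lemma cls_eqI: "E n x y \<Longrightarrow> cls n x = cls n y"
  using cls_eq_iff topspace by blast

lemma anti: "m \<le> n \<Longrightarrow> E n x y \<Longrightarrow> E m x y"
  by (induction rule: dec_induct) (auto dest: anti_Suc)

lemma r_mono: "m \<le> n \<Longrightarrow> r n \<le> r m"
  by (rule lift_Suc_antimono_le[of r]) (auto simp: r_dec less_imp_le)

lemma r_strict: "m < n \<Longrightarrow> r n < r m"
  using r_mono[of "Suc m" n] r_dec[of m] by auto

lemma r_less: "0 < e \<Longrightarrow> \<exists>n\<ge>m. r n < e"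
  using order_tendstoD(2)[OF r_lim, of e] unfolding eventually_sequentially by (meson nle_le)

section \<open>The ultrametric of a tower\<close>

definition tdist :: "'a \<Rightarrow> 'a \<Rightarrow> real" where
  "tdist x y = (if \<forall>n. E n x y then 0 else r (LEAST n. \<not> E n x y))"

text \<open>For points first separated at level \<open>k\<close>, both sides amount to
  \<open>n < k\<close>: \<open>r\<close> strictly decreases and the classes shrink. Metric questions
  thereby become questions about classes.\<close>

lemma tdist_less_iff: "tdist x y < r n \<longleftrightarrow> E n x y"
proof (cases "\<forall>n. E n x y")
  case True
  then show ?thesis by (simp add: tdist_def r_pos)
next
  case False
  define k where "k = (LEAST n. \<not> E n x y)"
  have k: "\<not> E k x y" "\<And>j. j < k \<Longrightarrow> E j x y"
    using False LeastI_ex[of "\<lambda>n. \<not> E n x y"] not_less_Least unfolding k_def by auto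
  have "r k < r n \<longleftrightarrow> n < k"
    using r_strict r_mono by (meson not_less)
  moreover have "E n x y \<longleftrightarrow> n < k"
    using k anti by (meson not_less)
  moreover have "tdist x y = r k"
    using False unfolding tdist_def k_def by (rule if_not_P)
  ultimately show ?thesis by simp
qed

lemma tdist_cases: "tdist x y = 0 \<or> (\<exists>k. tdist x y = r k)"
  by (auto simp: tdist_def)

lemma tdist_nonneg: "0 \<le> tdist x y"
  by (simp add: tdist_def r_pos less_imp_le)

lemma tdist_commute: "tdist x y = tdist y x"
proof -
  have "E n x y = E n y x" for n using sym by blast
  then show ?thesis by (simp add: tdist_def)
qed

text \<open>A violation makes \<open>tdist x z\<close> some \<open>r k\<close>; the two smaller
  distances then put all three points into one class of level \<open>k\<close>, so that
  \<open>tdist x z < r k\<close>.\<close>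

lemma tdist_ultra: "tdist x z \<le> max (tdist x y) (tdist y z)"
proof (rule ccontr)
  assume "\<not> ?thesis"
  then have *: "tdist x y < tdist x z" "tdist y z < tdist x z" by auto
  then obtain k where k: "tdist x z = r k"
    using tdist_cases[of x z] tdist_nonneg[of x y] by auto
  then have "E k x z" using * tdist_less_iff trans by metis
  then show False using k tdist_less_iff by (metis less_irrefl)
qed

lemma Metric_space_tdist: "Metric_space (topspace X) tdist"
proof
  show "0 \<le> tdist x y" for x y by (rule tdist_nonneg)
  show "tdist x y = tdist y x" for x y by (rule tdist_commute)
  show "tdist x y = 0 \<longleftrightarrow> x = y" if "x \<in> topspace X" for x y
    using separated[OF that] refl[OF that] r_pos tdist_less_iff tdist_nonneg
    by (metis tdist_def)
  show "tdist x z \<le> tdist x y + tdist y z" for x y z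
    using tdist_ultra[of x z y] tdist_nonneg[of x y] tdist_nonneg[of y z] by linarith
qed

sublocale M: Metric_space "topspace X" tdist
  by (rule Metric_space_tdist)

lemma mball_r: "M.mball x (r n) = cls n x"
  using topspace topspace' by (auto simp: tdist_less_iff)

lemma mtopology_tdist: "M.mtopology = X"
  unfolding topology_eq
proof (intro allI iffI)
  fix U assume U: "openin M.mtopology U"
  show "openin X U"
  proof (subst openin_subopen, intro ballI)
    fix x assume x: "x \<in> U"
    then obtain e where "e > 0" "M.mball x e \<subseteq> U" and xX: "x \<in> topspace X"
      using U unfolding M.openin_mtopology by blast
    moreover obtain n where "r n < e" using r_less[OF \<open>e > 0\<close>] by blast
    ultimately have "cls n x \<subseteq> U"
      by (metis M.mball_subset_concentric less_imp_le mball_r order_trans)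
    then show "\<exists>T. openin X T \<and> x \<in> T \<and> T \<subseteq> U"
      using openin_cls refl[OF xX] by (intro exI[of _ "cls n x"]) simp
  qed
next
  fix U assume U: "openin X U"
  show "openin M.mtopology U"
    unfolding M.openin_mtopology
  proof (intro conjI allI impI)
    show "U \<subseteq> topspace X" using U openin_subset by blast
    fix x assume "x \<in> U"
    then obtain n where "cls n x \<subseteq> U" using basis[OF U] by (auto simp: cls_def)
    then have "M.mball x (r n) \<subseteq> U" by (simp add: mball_r)
    then show "\<exists>e>0. M.mball x e \<subseteq> U" using r_pos by blast
  qed
qed

lemma Hausdorff: "Hausdorff_space X"
  using M.Hausdorff_space_mtopology mtopology_tdist by simp

abbreviation tmetric :: "'a metric" where
  "tmetric \<equiv> metric (topspace X, tdist)"

text \<open>The numbers \<open>r\<close> alone decide where the values lie, so every tower on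
  \<open>X\<close> with the same \<open>r\<close> yields a member of
  \<open>UMet_bd X R\<close>.\<close>

lemma tmetric_in_UMet_bd:
  assumes "range r \<subseteq> R" "0 \<in> R"
  shows "tmetric \<in> UMet_bd X R"
proof -
  have "ultrametric tmetric"
    by (simp add: ultrametric_def tdist_ultra)
  moreover have "valued_in tmetric R"
    using tdist_cases assms unfolding valued_in_def by (metis M.mdist_metric range_subsetD)
  moreover have "tdist x y \<le> r 0" for x y
    using tdist_cases[of x y] r_mono[of 0] r_pos[of 0] by auto
  then have "bounded_metric tmetric"
    by (auto simp: bounded_metric_def M.mbounded_alt)
  ultimately show ?thesis
    by (simp add: UMet_bd_def mtopology_tdist)
qed

section \<open>Completeness expressed by classes\<close>

definition tcauchy :: "(nat \<Rightarrow> 'a) \<Rightarrow> bool" where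
  "tcauchy \<sigma> \<longleftrightarrow> (\<forall>n. \<exists>K. \<forall>i\<ge>K. \<forall>j\<ge>K. E n (\<sigma> i) (\<sigma> j))"

text \<open>Completeness depends on the partitions and not on \<open>r\<close>. Two towers with the
  same topology may disagree on it, and the whole argument exploits this.\<close>

definition tcomplete :: "'a set \<Rightarrow> bool" where
  "tcomplete S \<longleftrightarrow> S \<subseteq> topspace X \<and>
     (\<forall>\<sigma>. range \<sigma> \<subseteq> S \<longrightarrow> tcauchy \<sigma> \<longrightarrow> (\<exists>x\<in>S. \<forall>n. \<forall>\<^sub>F i in sequentially. E n x (\<sigma> i)))"

lemma MCauchy_iff: "M.MCauchy \<sigma> \<longleftrightarrow> range \<sigma> \<subseteq> topspace X \<and> tcauchy \<sigma>"
proof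
  assume "M.MCauchy \<sigma>"
  then show "range \<sigma> \<subseteq> topspace X \<and> tcauchy \<sigma>"
    unfolding M.MCauchy_def tcauchy_def by (meson r_pos tdist_less_iff)
next
  assume \<sigma>: "range \<sigma> \<subseteq> topspace X \<and> tcauchy \<sigma>"
  show "M.MCauchy \<sigma>"
    unfolding M.MCauchy_def
  proof (intro conjI allI impI)
    fix e :: real assume "e > 0"
    then obtain n where n: "r n < e" using r_less by blast
    obtain K where "\<forall>i\<ge>K. \<forall>j\<ge>K. E n (\<sigma> i) (\<sigma> j)"
      using \<sigma> unfolding tcauchy_def by blast
    then show "\<exists>K. \<forall>i j. K \<le> i \<longrightarrow> K \<le> j \<longrightarrow> tdist (\<sigma> i) (\<sigma> j) < e"
      using n tdist_less_iff by (meson less_trans)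
  qed (use \<sigma> in blast)
qed

lemma limitin_iff:
  "limitin X \<sigma> x sequentially \<longleftrightarrow> x \<in> topspace X \<and> (\<forall>n. \<forall>\<^sub>F i in sequentially. E n x (\<sigma> i))"
proof
  assume L: "limitin X \<sigma> x sequentially"
  then have "x \<in> topspace X" by (rule limitin_topspace)
  moreover have "\<forall>\<^sub>F i in sequentially. \<sigma> i \<in> cls n x" for n
    by (rule limitinD[OF L openin_cls]) (simp add: refl[OF \<open>x \<in> topspace X\<close>])
  ultimately show "x \<in> topspace X \<and> (\<forall>n. \<forall>\<^sub>F i in sequentially. E n x (\<sigma> i))" by simp
next
  assume R: "x \<in> topspace X \<and> (\<forall>n. \<forall>\<^sub>F i in sequentially. E n x (\<sigma> i))"
  show "limitin X \<sigma> x sequentially"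
    unfolding limitin_def
  proof (intro conjI allI impI)
    fix U assume "openin X U \<and> x \<in> U"
    then obtain n where "{y. E n x y} \<subseteq> U" using basis by blast
    then show "\<forall>\<^sub>F i in sequentially. \<sigma> i \<in> U"
      using R by (metis (mono_tags, lifting) eventually_mono mem_Collect_eq subsetD)
  qed (use R in blast)
qed

lemma tcomplete_Int_closedin:
  assumes "tcomplete S" "closedin X C"
  shows "tcomplete (S \<inter> C)"
  unfolding tcomplete_def
proof (intro conjI allI impI)
  fix \<sigma> assume \<sigma>: "range \<sigma> \<subseteq> S \<inter> C" "tcauchy \<sigma>"
  then obtain x where x: "x \<in> S" "\<And>n. \<forall>\<^sub>F i in sequentially. E n x (\<sigma> i)"
    using assms(1) unfolding tcomplete_def by blast
  have "limitin X \<sigma> x sequentially"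
    using x assms(1) unfolding limitin_iff tcomplete_def by blast
  then have "x \<in> C"
    by (rule limitin_closedin[OF _ assms(2)]) (use \<sigma>(1) in \<open>auto intro!: always_eventually\<close>)
  then show "\<exists>x\<in>S \<inter> C. \<forall>n. \<forall>\<^sub>F i in sequentially. E n x (\<sigma> i)" using x by blast
qed (use assms in \<open>auto simp: tcomplete_def\<close>)

lemma tcomplete_imp_mcomplete:
  assumes "tcomplete S"
  shows "Metric_space.mcomplete S tdist"
proof -
  interpret S: Submetric "topspace X" tdist S
    by unfold_locales (use assms in \<open>auto simp: tcomplete_def\<close>)
  show ?thesis
    unfolding S.sub.mcomplete_def
  proof (intro allI impI)
    fix \<sigma> assume "S.sub.MCauchy \<sigma>"
    then have "M.MCauchy \<sigma>" and \<sigma>: "range \<sigma> \<subseteq> S"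
      using S.subset by (auto simp: S.sub.MCauchy_def M.MCauchy_def)
    then obtain x where x: "x \<in> S" "\<And>n. \<forall>\<^sub>F i in sequentially. E n x (\<sigma> i)"
      using assms unfolding MCauchy_iff tcomplete_def by blast
    then have "limitin X \<sigma> x sequentially"
      using S.subset unfolding limitin_iff by blast
    then show "\<exists>x. limitin S.sub.mtopology \<sigma> x sequentially"
      using x \<sigma> unfolding S.mtopology_submetric mtopology_tdist limitin_subtopology
      by (intro exI[of _ x]) (auto intro!: always_eventually)
  qed
qed

text \<open>Baire's theorem in the complete space \<open>Z\<close>: if every closed trace
  \<open>Z \<inter> F k\<close> had empty interior in \<open>Z\<close>, so would \<open>Z\<close>
  itself.\<close>

lemma tcomplete_Baire:
  assumes "tcomplete Z" "Z \<noteq> {}" "Z \<subseteq> (\<Union>k::nat. F k)" "\<And>k. closedin X (F k)"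
  shows "\<exists>k n. \<exists>x\<in>Z. Z \<inter> cls n x \<subseteq> F k"
proof -
  interpret Z: Submetric "topspace X" tdist Z
    by unfold_locales (use assms in \<open>auto simp: tcomplete_def\<close>)
  have top: "Z.sub.mtopology = subtopology X Z"
    by (simp add: Z.mtopology_submetric mtopology_tdist)
  have "\<exists>k. subtopology X Z interior_of (Z \<inter> F k) \<noteq> {}"
  proof (rule ccontr)
    assume *: "\<not> ?thesis"
    have "Z.sub.mtopology interior_of \<Union>(range (\<lambda>k. Z \<inter> F k)) = {}"
    proof (rule Z.sub.metric_Baire_category_alt[OF tcomplete_imp_mcomplete[OF assms(1)]])
      show "closedin Z.sub.mtopology T \<and> Z.sub.mtopology interior_of T = {}"
        if "T \<in> range (\<lambda>k. Z \<inter> F k)" for T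
        using that * assms(4) unfolding top by (auto simp: closedin_subtopology)
    qed auto
    moreover have "\<Union>(range (\<lambda>k. Z \<inter> F k)) = Z" using assms(3) by auto
    ultimately show False
      using assms(2) by (metis Z.sub.topspace_mtopology interior_of_topspace)
  qed
  then obtain k x T where "openin (subtopology X Z) T" "x \<in> T" "T \<subseteq> Z \<inter> F k"
    unfolding interior_of_def by blast
  then obtain U where U: "openin X U" "x \<in> U" "x \<in> Z" "U \<inter> Z \<subseteq> F k"
    by (auto simp: openin_subtopology)
  obtain n where "cls n x \<subseteq> U" using basis[OF U(1,2)] by (auto simp: cls_def)
  then show ?thesis using U by blast
qed

text \<open>A Cauchy sequence in \<open>F k\<close> converges in the completion. Its limit stays in
  the closed set \<open>C k\<close>, which lies inside the image of the space, so the limit comes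
  from a point of \<open>F k\<close>.\<close>

lemma fsigma_in_completion_imp_tcomplete:
  assumes "fsigma_in (mtopology_of (completion_metric tmetric)) (completion_embed tmetric ` topspace X)"
  obtains F :: "nat \<Rightarrow> 'a set" where "(\<Union>k. F k) = topspace X" "\<And>k. closedin X (F k)" "\<And>k. tcomplete (F k)"
proof -
  let ?Y = "mtopology_of (completion_metric tmetric)" and ?e = "completion_embed tmetric"
  obtain C :: "nat \<Rightarrow> _" where C: "\<And>n. closedin ?Y (C n)" "(\<Union>n. C n) = ?e ` topspace X"
    using assms unfolding fsigma_in_ascending by auto
  define F where "F k = {x \<in> topspace X. ?e x \<in> C k}" for k
  have "(\<Union>k. F k) = topspace X"
    using C(2) unfolding F_def by blast
  moreover have "closedin X (F k)" for k
  proof -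
    have "continuous_map X ?Y ?e"
      using embedding_map_completion_embed[of tmetric] homeomorphic_imp_continuous_map
        continuous_map_in_subtopology
      unfolding embedding_map_def by (metis M.mtopology_of mtopology_tdist)
    from closedin_continuous_map_preimage[OF this C(1)] show ?thesis
      unfolding F_def .
  qed
  moreover have "tcomplete (F k)" for k
    unfolding tcomplete_def
  proof (intro conjI allI impI)
    show "F k \<subseteq> topspace X" by (auto simp: F_def)
    fix \<sigma> assume \<sigma>: "range \<sigma> \<subseteq> F k" "tcauchy \<sigma>"
    interpret Y: Metric_space "completion_space tmetric" "completion_dist tmetric"
      by (rule Metric_space_completion)
    have top: "?Y = Y.mtopology" by (simp add: mtopology_of_def)
    have \<sigma>X: "\<sigma> i \<in> topspace X" for i using \<sigma>(1) by (auto simp: F_def)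
    have cau: "cauchy_in tmetric \<sigma>"
      using \<sigma> \<sigma>X by (auto simp: MCauchy_iff)
    define P where "P = cauchy_rel tmetric `` {\<sigma>}"
    have P: "P \<in> completion_space tmetric" by (simp add: P_def completion_class[OF cau])
    have e: "?e x \<in> completion_space tmetric" if "x \<in> topspace X" for x
      using completion_embed_mem[of tmetric] that by auto
    have lim: "(\<lambda>i. completion_dist tmetric (?e (\<sigma> i)) P) \<longlonglongrightarrow> 0"
      using completion_embed_tendsto[OF cau] by (simp add: P_def)
    then have "limitin ?Y (\<lambda>i. ?e (\<sigma> i)) P sequentially"
      unfolding top Y.limitin_metric_dist_null using P e \<sigma>X by (auto simp: always_eventually)
    then have "P \<in> C k"
      by (rule limitin_closedin[OF _ C(1)])
        (use \<sigma>(1) in \<open>auto simp: F_def image_subset_iff intro!: always_eventually\<close>)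
    then obtain x where x: "x \<in> topspace X" "P = ?e x" using C(2) by blast
    then have "x \<in> F k" using \<open>P \<in> C k\<close> by (simp add: F_def)
    moreover have "\<forall>\<^sub>F i in sequentially. E n x (\<sigma> i)" for n
    proof -
      have "(\<lambda>i. tdist (\<sigma> i) x) \<longlonglongrightarrow> 0"
        using lim completion_embed_isometry[of _ tmetric x] x \<sigma>X by simp
      from order_tendstoD(2)[OF this r_pos[of n]] show ?thesis
        by (rule eventually_mono) (auto simp: tdist_less_iff intro: sym)
    qed
    ultimately show "\<exists>x\<in>F k. \<forall>n. \<forall>\<^sub>F i in sequentially. E n x (\<sigma> i)" by blast
  qed
  ultimately show thesis by (rule that)
qed

text \<open>Every point of \<open>S\<close> has a largest class in which \<open>S\<close> is sigma-locally compact; these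
  classes are disjoint and open, so their pieces can be glued index by index.\<close>

lemma sigma_locally_compact_in_local:
  assumes "S \<subseteq> topspace X" and loc: "\<And>x. x \<in> S \<Longrightarrow> \<exists>n. sigma_locally_compact_in X (S \<inter> cls n x)"
  shows "sigma_locally_compact_in X S"
proof -
  define N where "N x = (LEAST n. sigma_locally_compact_in X (S \<inter> cls n x))" for x
  define B where "B x = cls (N x) x" for x
  have slc: "sigma_locally_compact_in X (S \<inter> B x)" if "x \<in> S" for x
    unfolding B_def N_def by (rule LeastI_ex) (rule loc[OF that])
  \<comment> \<open>\<open>E (N x) x y\<close> makes the classes of \<open>x\<close> and
    \<open>y\<close> at level \<open>N x\<close> equal, so \<open>N x\<close> is a candidate for the
    minimum defining \<open>N y\<close>.\<close>
  have N_le: "N y \<le> N x" if "x \<in> S" "E (N x) x y" for x y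
    unfolding N_def[of y] using slc[OF that(1)] cls_eqI[OF that(2)] by (intro Least_le) (simp add: B_def)
  have B_eq': "B x = B y" if "x \<in> S" "y \<in> S" "E (N x) x y" for x y
  proof -
    have "E (N y) y x" using sym[OF that(3)] N_le[OF that(1,3)] anti by blast
    then have "N x = N y" using N_le that by (meson le_antisym)
    then show ?thesis using cls_eqI[OF that(3)] by (simp add: B_def)
  qed
  have B_eq: "B x = B y" if "x \<in> S" "y \<in> S" "B x \<inter> B y \<inter> S \<noteq> {}" for x y
  proof -
    obtain z where "z \<in> S" "E (N x) x z" "E (N y) y z"
      using \<open>B x \<inter> B y \<inter> S \<noteq> {}\<close> unfolding B_def by auto
    then show ?thesis using B_eq' \<open>x \<in> S\<close> \<open>y \<in> S\<close> by metis
  qed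
  have "\<forall>T\<in>B ` S. \<exists>L. (\<Union>n::nat. L n) = S \<inter> T \<and> (\<forall>n. locally_compact_space (subtopology X (L n)))"
    using slc by (auto simp: sigma_locally_compact_in_def)
  \<comment> \<open>Pieces are chosen per set \<open>B x\<close>, not per point, so points with the
    same class share their pieces.\<close>
  then obtain f where f: "\<And>x. x \<in> S \<Longrightarrow> (\<Union>n::nat. f (B x) n) = S \<inter> B x"
    "\<And>x n. x \<in> S \<Longrightarrow> locally_compact_space (subtopology X (f (B x) n))"
    by (metis imageI)
  define L where "L n = (\<Union>x\<in>S. f (B x) n)" for n
  have "(\<Union>n. L n) = S"
  proof
    show "(\<Union>n. L n) \<subseteq> S" using f(1) by (fastforce simp: L_def)
    show "S \<subseteq> (\<Union>n. L n)"
    proof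
      fix x assume x: "x \<in> S"
      then have "x \<in> S \<inter> B x" using assms(1) refl by (auto simp: B_def)
      then obtain n where "x \<in> f (B x) n" using f(1)[OF x] by blast
      then show "x \<in> (\<Union>n. L n)" using x by (auto simp: L_def)
    qed
  qed
  moreover have "locally_compact_space (subtopology X (L n))" for n
  proof (rule locally_compact_space_local)
    fix y assume "y \<in> topspace X \<inter> L n"
    then obtain x where x: "x \<in> S" "y \<in> f (B x) n" by (auto simp: L_def)
    \<comment> \<open>The pieces lie in \<open>S\<close>, and distinct sets \<open>B w\<close> and
      \<open>B x\<close> are disjoint on \<open>S\<close>, so nothing foreign enters
      \<open>B x\<close>.\<close>
    have "L n \<inter> B x = f (B x) n"
    proof
      show "f (B x) n \<subseteq> L n \<inter> B x" using f(1)[OF x(1)] x(1) by (auto simp: L_def)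
      show "L n \<inter> B x \<subseteq> f (B x) n"
      proof
        fix z assume z: "z \<in> L n \<inter> B x"
        then obtain w where w: "w \<in> S" "z \<in> f (B w) n" by (auto simp: L_def)
        then have "z \<in> S \<inter> B w" using f(1)[OF w(1)] by blast
        then have "B w = B x" using B_eq[OF w(1) x(1)] z by blast
        then show "z \<in> f (B x) n" using w by simp
      qed
    qed
    then have "locally_compact_space (subtopology X (L n \<inter> B x))" "y \<in> B x"
      using f x by auto
    then show "\<exists>U. openin X U \<and> y \<in> U \<and> locally_compact_space (subtopology X (L n \<inter> U))"
      using openin_cls unfolding B_def by blast
  qed
  ultimately show ?thesis unfolding sigma_locally_compact_in_def by blast
qed

section \<open>Noncompact kernels and infinite branching\<close>

text \<open>The part removed from \<open>S\<close> is locally, hence globally, sigma-locally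
  compact. If \<open>Z\<close> had a compact trace on a class of one of its points, joining the
  removed part to it would show that this class should have been removed too.\<close>

lemma noncompact_kernel:
  assumes S: "tcomplete S" and not: "\<not> sigma_locally_compact_in X S"
  obtains Z where "tcomplete Z" "Z \<noteq> {}" "\<And>n x. x \<in> Z \<Longrightarrow> \<not> compactin X (Z \<inter> cls n x)"
proof -
  let ?U = "\<Union>{cls n x |n x. x \<in> S \<and> sigma_locally_compact_in X (S \<inter> cls n x)}"
  define Z where "Z = S - ?U"
  have SX: "S \<subseteq> topspace X" using S by (simp add: tcomplete_def)
  have "Z = S \<inter> (topspace X - ?U)" using SX by (auto simp: Z_def)
  moreover have "openin X ?U" using openin_cls by (intro openin_Union) blast
  then have "closedin X (topspace X - ?U)" by (intro closedin_diff closedin_topspace)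
  ultimately have "tcomplete Z"
    using tcomplete_Int_closedin[OF S] by simp
  have D: "sigma_locally_compact_in X (S - Z)"
  proof (rule sigma_locally_compact_in_local)
    fix y assume "y \<in> S - Z"
    then obtain n x where x: "x \<in> S" "E n x y" "sigma_locally_compact_in X (S \<inter> cls n x)"
      unfolding Z_def by auto
    \<comment> \<open>The class of \<open>x\<close> was removed entirely, and it is also the class
      of \<open>y\<close> at level \<open>n\<close>.\<close>
    then have "(S - Z) \<inter> cls n y = S \<inter> cls n x"
      using cls_eqI[OF x(2)] unfolding Z_def by blast
    then show "\<exists>n. sigma_locally_compact_in X ((S - Z) \<inter> cls n y)" using x(3) by metis
  qed (use SX in auto)
  have "Z \<noteq> {}" using D not by auto
  moreover have "\<not> compactin X (Z \<inter> cls n x)" if "x \<in> Z" for n x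
  proof
    assume "compactin X (Z \<inter> cls n x)"
    then have "sigma_locally_compact_in X ((Z \<inter> cls n x) \<union> ((S - Z) \<inter> cls n x))"
      by (intro sigma_locally_compact_in_Un compactin_imp_sigma_locally_compact_in
          sigma_locally_compact_in_Int_openin Hausdorff D openin_cls)
    moreover have "(Z \<inter> cls n x) \<union> ((S - Z) \<inter> cls n x) = S \<inter> cls n x"
      unfolding Z_def by blast
    ultimately have "sigma_locally_compact_in X (S \<inter> cls n x)" by simp
    moreover have "x \<in> cls n x" "x \<in> S" using that SX refl by (auto simp: Z_def)
    ultimately show False using that unfolding Z_def by blast
  qed
  ultimately show thesis using that \<open>tcomplete Z\<close> by blast
qed

text \<open>Finite branching leaves finitely many classes at each deeper level, hence total
  boundedness, and completeness turns this into compactness. Read contrapositively, it finds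
  infinite branching below every noncompact trace.\<close>

lemma compactin_if_finitely_branching:
  assumes Z: "tcomplete Z" and x: "x \<in> Z"
    and fin: "\<And>m y. y \<in> Z \<Longrightarrow> n \<le> m \<Longrightarrow> E n x y \<Longrightarrow> finite (cls (Suc m) ` (Z \<inter> cls m y))"
  shows "compactin X (Z \<inter> cls n x)"
proof -
  let ?B = "Z \<inter> cls n x"
  have "closedin X (cls n x)"
  proof -
    \<comment> \<open>The complement of a class is the union of the other classes of its level, so
      classes are closed as well as open.\<close>
    have "topspace X - cls n x = (\<Union>y\<in>topspace X - cls n x. cls n y)"
    proof (intro equalityI subsetI)
      fix z assume "z \<in> (\<Union>y\<in>topspace X - cls n x. cls n y)"
      then obtain y where "\<not> E n x y" "E n y z" by auto
      moreover have "\<not> E n x z" using calculation sym trans by blast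
      ultimately show "z \<in> topspace X - cls n x" using topspace' by simp
    next
      fix z assume "z \<in> topspace X - cls n x"
      then show "z \<in> (\<Union>y\<in>topspace X - cls n x. cls n y)"
        using refl by (intro UN_I[of z]) auto
    qed
    moreover have "openin X (\<Union>y\<in>topspace X - cls n x. cls n y)"
      using openin_cls by blast
    ultimately show ?thesis
      using openin_subset[OF openin_cls] by (simp add: closedin_def)
  qed
  then have comp: "tcomplete ?B" by (rule tcomplete_Int_closedin[OF Z])
  interpret B: Submetric "topspace X" tdist ?B
    by unfold_locales (use comp in \<open>auto simp: tcomplete_def\<close>)
  have finB: "finite (cls m ` ?B)" if "n \<le> m" for m
    using that
  proof (induction rule: dec_induct)
    case base
    have "cls n ` ?B \<subseteq> {cls n x}" using cls_eqI by fastforce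
    then show ?case using finite_subset by blast
  next
    case (step m)
    obtain K where K: "K \<subseteq> ?B" "finite K" "cls m ` ?B = cls m ` K"
      using step.IH finite_subset_image[of "cls m ` ?B" "cls m" ?B] by blast
    have "cls (Suc m) ` ?B \<subseteq> (\<Union>y\<in>K. cls (Suc m) ` (Z \<inter> cls m y))"
    proof
      fix T assume "T \<in> cls (Suc m) ` ?B"
      then obtain z where z: "z \<in> ?B" "T = cls (Suc m) z" by blast
      then obtain y where "y \<in> K" "cls m z = cls m y" using K(3) by blast
      moreover have "z \<in> cls m z" using z(1) topspace' refl by auto
      ultimately show "T \<in> (\<Union>y\<in>K. cls (Suc m) ` (Z \<inter> cls m y))" using z by blast
    qed
    moreover have "finite (\<Union>y\<in>K. cls (Suc m) ` (Z \<inter> cls m y))"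
    proof (rule finite_UN_I[OF K(2)])
      fix y assume "y \<in> K"
      then show "finite (cls (Suc m) ` (Z \<inter> cls m y))"
        using K(1) step.hyps(1) by (intro fin) auto
    qed
    ultimately show ?case by (rule finite_subset)
  qed
  have "B.sub.mtotally_bounded ?B"
    unfolding B.sub.mtotally_bounded_def
  proof (intro allI impI)
    fix e :: real assume "e > 0"
    then obtain m where m: "n \<le> m" "r m < e" using r_less by blast
    obtain K where K: "K \<subseteq> ?B" "finite K" "cls m ` ?B = cls m ` K"
      using finB[OF m(1)] finite_subset_image[of "cls m ` ?B" "cls m" ?B] by blast
    have "?B \<subseteq> (\<Union>y\<in>K. B.sub.mball y e)"
    proof
      fix z assume z: "z \<in> ?B"
      then obtain y where y: "y \<in> K" "cls m z = cls m y" using K(3) by blast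
      have "E m z z" using z topspace' refl by auto
      then have "tdist y z < r m" using y(2) tdist_less_iff by (metis mem_cls)
      then show "z \<in> (\<Union>y\<in>K. B.sub.mball y e)"
        using y(1) K(1) z m(2) by (fastforce simp: B.sub.in_mball)
    qed
    then show "\<exists>K. finite K \<and> K \<subseteq> ?B \<and> ?B \<subseteq> (\<Union>x\<in>K. B.sub.mball x e)" using K by blast
  qed
  then have "compact_space B.sub.mtopology"
    using tcomplete_imp_mcomplete[OF comp] by (simp add: B.sub.compact_space_eq_mcomplete_mtotally_bounded)
  then show ?thesis
    using B.subset by (simp add: B.mtopology_submetric mtopology_tdist compactin_subspace)
qed

end


section \<open>Splitting the infinite branchings that meet a given set\<close>

lemma exists_surjective_index:
  assumes "infinite \<K>"
  shows "\<exists>g. \<forall>i::nat. \<exists>K\<in>\<K>. g K = i"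
proof -
  obtain f :: "nat \<Rightarrow> _" where f: "inj f" "range f \<subseteq> \<K>"
    using infinite_countable_subset[OF assms] by blast
  then show ?thesis
    by (intro exI[of _ "inv f"]) (metis inv_f_f range_subsetD)
qed

text \<open>The function is chosen from the set \<K> alone, so all points of one class share it. The
  implication keeps the choice consistent for finite \<K>, where the indices are arbitrary.\<close>

definition child_index :: "'b set \<Rightarrow> 'b \<Rightarrow> nat" where
  "child_index \<K> = (SOME g. infinite \<K> \<longrightarrow> (\<forall>i. \<exists>K\<in>\<K>. g K = i))"

lemma child_index_surjective:
  assumes "infinite \<K>"
  shows "\<exists>K\<in>\<K>. child_index \<K> K = i"
  using someI_ex[of "\<lambda>g. infinite \<K> \<longrightarrow> (\<forall>i. \<exists>K\<in>\<K>. g K = i)"] exists_surjective_index[OF assms] assms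
  unfolding child_index_def by blast

context clopen_tower
begin

definition children :: "'a set \<Rightarrow> nat \<Rightarrow> 'a \<Rightarrow> 'a set set" where
  "children Z n x = cls (Suc n) ` (Z \<inter> cls n x)"

text \<open>When infinitely many children of the \<open>n\<close>-th class of \<open>x\<close> meet \<open>Z\<close>, the index tells in which
  step the child containing \<open>x\<close> is cut off; \<open>depth\<close> adds up these delays, so that it bounds the
  level at which \<open>x\<close> gets separated from the other points of its \<open>n\<close>-th class.\<close>

definition index :: "'a set \<Rightarrow> nat \<Rightarrow> 'a \<Rightarrow> nat" where
  "index Z n x = child_index (children Z n x) (cls (Suc n) x)"

definition depth :: "'a set \<Rightarrow> nat \<Rightarrow> 'a \<Rightarrow> nat" where
  "depth Z n x = n + (\<Sum>j\<le>n. index Z j x)"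

text \<open>Points are told apart at step \<open>N\<close> if, at some level \<open>n\<close> with
  \<open>E (Suc n)\<close> failing, one of them has depth below \<open>N\<close>. As
  \<open>depth\<close> grows with \<open>n\<close>, the first such level decides.
  \<open>split Z 0\<close> relates all points.\<close>

definition split :: "'a set \<Rightarrow> nat \<Rightarrow> 'a \<Rightarrow> 'a \<Rightarrow> bool" where
  "split Z N x y \<longleftrightarrow> x \<in> topspace X \<and> y \<in> topspace X \<and>
     (\<forall>n. E (Suc n) x y \<or> N \<le> depth Z n x \<and> N \<le> depth Z n y)"

section \<open>Comparing the split tower with the original one\<close>

lemma index_cong:
  assumes "E (Suc n) x y"
  shows "index Z n x = index Z n y"
  using cls_eqI[OF assms] cls_eqI[OF anti_Suc[OF assms]] by (simp add: index_def children_def)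

lemma depth_cong:
  assumes "E (Suc n) x y"
  shows "depth Z n x = depth Z n y"
proof -
  have "index Z j x = index Z j y" if "j \<le> n" for j
    using that by (intro index_cong anti[OF _ assms]) simp
  then show ?thesis by (simp add: depth_def)
qed

lemma level_le_depth: "n \<le> depth Z n x"
  by (simp add: depth_def)

lemma index_le_depth:
  assumes "m \<le> n"
  shows "index Z m x \<le> depth Z n x"
  using member_le_sum[of m "{..n}" "\<lambda>j. index Z j x"] assms by (simp add: depth_def)

lemma index_surjective:
  assumes "infinite (children Z n x)"
  shows "\<exists>z\<in>Z \<inter> cls n x. index Z n z = i"
proof -
  obtain z where z: "z \<in> Z \<inter> cls n x" "child_index (children Z n x) (cls (Suc n) z) = i"
    using child_index_surjective[OF assms, of i] by (auto simp: children_def)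
  moreover have "children Z n z = children Z n x"
    using z(1) cls_eqI[of n x z] by (simp add: children_def)
  ultimately show ?thesis by (intro bexI[of _ z]) (simp_all add: index_def)
qed

text \<open>For \<open>n \<le> N\<close> the points are still together at level
  \<open>Suc n\<close>; for larger \<open>n\<close> the depth is at least the level. The new classes
  are therefore unions of old ones, hence open.\<close>

lemma split_if_E_Suc:
  assumes "E (Suc N) x y"
  shows "split Z N x y"
  unfolding split_def
proof (intro conjI allI)
  fix n
  show "E (Suc n) x y \<or> N \<le> depth Z n x \<and> N \<le> depth Z n y"
    using anti[OF _ assms, of "Suc n"] level_le_depth[of n Z x] level_le_depth[of n Z y] by fastforce
qed (use assms topspace topspace' in blast)+

text \<open>The step exceeds the depth of \<open>x\<close>, which excludes the second alternative at
  level \<open>n\<close>. It depends on the point \<open>x\<close>, so the topologies agree while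
  the Cauchy sequences may differ.\<close>

lemma E_if_split: "split Z (Suc (depth Z n x)) x y \<Longrightarrow> E (Suc n) x y"
  unfolding split_def by (meson not_less_eq_eq order_refl)

lemma clopen_tower_split: "clopen_tower X (split Z) r"
proof
  show "split Z n x x" if "x \<in> topspace X" for n x
    using that refl by (simp add: split_def)
  show sym': "split Z n y x" if "split Z n x y" for n x y
    using that sym unfolding split_def by blast
  show trans': "split Z n x z" if "split Z n x y" "split Z n y z" for n x y z
    unfolding split_def
  proof (intro conjI allI)
    fix k
    have "E (Suc k) x y \<or> n \<le> depth Z k x \<and> n \<le> depth Z k y"
      "E (Suc k) y z \<or> n \<le> depth Z k y \<and> n \<le> depth Z k z"
      using that unfolding split_def by blast+
    \<comment> \<open>If only one of the two pairs is separated at level \<open>k\<close>,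
      \<open>depth_cong\<close> carries the bound across the other pair.\<close>
    then show "E (Suc k) x z \<or> n \<le> depth Z k x \<and> n \<le> depth Z k z"
      using trans[of "Suc k" x y z] depth_cong[of k x y Z] depth_cong[of k y z Z] by auto
  qed (use that split_def in blast)+
  show "split Z n x y" if "split Z (Suc n) x y" for n x y
    using that unfolding split_def by (meson Suc_leD)
  show "openin X {y. split Z n x y}" for n x
  proof (subst openin_subopen, intro ballI)
    fix y assume "y \<in> {y. split Z n x y}"
    then have y: "split Z n x y" by simp
    then have "cls (Suc n) y \<subseteq> {y. split Z n x y}"
      using split_if_E_Suc trans' by auto
    moreover have "y \<in> cls (Suc n) y"
      using y refl by (simp add: split_def)
    ultimately show "\<exists>T. openin X T \<and> y \<in> T \<and> T \<subseteq> {y. split Z n x y}"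
      using openin_cls by blast
  qed
  show "\<exists>n. {y. split Z n x y} \<subseteq> U" if U: "openin X U" "x \<in> U" for U x
  proof -
    obtain n where "{y. E n x y} \<subseteq> U" using basis[OF U] by blast
    then have "{y. split Z (Suc (depth Z n x)) x y} \<subseteq> U"
      using anti_Suc[OF E_if_split] by auto
    then show ?thesis by blast
  qed
  show "x = y" if x: "x \<in> topspace X" and "\<And>n. split Z n x y" for x y
    using E_if_split that(2) anti_Suc by (intro separated[OF x]) blast
qed (auto simp: split_def r_pos r_dec r_lim)

text \<open>By the Baire category theorem some \<open>F k\<close> contains \<open>Z\<close> locally, hence also a sequence in \<open>Z\<close>
  running through infinitely many children of one class; the new tower makes it Cauchy.\<close>

lemma no_tcomplete_split_cover:
  assumes Z: "tcomplete Z" "Z \<noteq> {}"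
    and noncompact: "\<And>n x. x \<in> Z \<Longrightarrow> \<not> compactin X (Z \<inter> cls n x)"
    and F: "(\<Union>k::nat. F k) = topspace X" "\<And>k. closedin X (F k)"
  shows "\<exists>k. \<not> clopen_tower.tcomplete X (split Z) (F k)"
proof -
  interpret S: clopen_tower X "split Z" r by (rule clopen_tower_split)
  have "Z \<subseteq> (\<Union>k. F k)" using Z(1) F(1) by (simp add: tcomplete_def)
  from tcomplete_Baire[OF Z this F(2)]
  obtain k n x where x: "x \<in> Z" "Z \<inter> cls n x \<subseteq> F k" by blast
  obtain m y where y: "n \<le> m" "E n x y" "infinite (children Z m y)"
    using compactin_if_finitely_branching[OF Z(1) x(1), of n] noncompact[OF x(1), of n]
    unfolding children_def by blast
  \<comment> \<open>One point of \<open>Z\<close> for every index; by \<open>index_cong\<close>,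
    different indices mean different children.\<close>
  obtain z where z: "\<And>i. z i \<in> Z \<inter> cls m y" "\<And>i. index Z m (z i) = i"
    using index_surjective[OF y(3)] by metis
  have zF: "range z \<subseteq> F k"
  proof -
    have "Z \<inter> cls m y \<subseteq> Z \<inter> cls n x"
      using anti[OF y(1)] trans[OF y(2)] by auto
    then show ?thesis using z(1) x(2) by blast
  qed
  have zz: "E m (z i) (z j)" for i j
    using z(1) sym trans by (meson IntD2 mem_cls)
  have "S.tcauchy z"
    unfolding S.tcauchy_def
  proof (intro allI exI impI)
    \<comment> \<open>The witness is \<open>N\<close> itself: the points share their classes up to
      level \<open>m\<close>, and from level \<open>m\<close> on the depth of \<open>z i\<close>
      includes the index \<open>i\<close>, which is at least \<open>N\<close>.\<close>
    fix N i j :: nat assume ij: "N \<le> i" "N \<le> j"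
    show "split Z N (z i) (z j)"
      unfolding split_def
    proof (intro conjI allI)
      show "z i \<in> topspace X" "z j \<in> topspace X" using zz topspace by blast+
      fix l
      show "E (Suc l) (z i) (z j) \<or> N \<le> depth Z l (z i) \<and> N \<le> depth Z l (z j)"
      proof (cases "m \<le> l")
        case True
        then show ?thesis
          using index_le_depth[of m l Z "z i"] index_le_depth[of m l Z "z j"] z(2) ij by simp
      next
        case False
        then show ?thesis using anti[OF _ zz, of "Suc l"] by simp
      qed
    qed
  qed
  \<comment> \<open>A limit \<open>w\<close> would have almost all \<open>z i\<close> in its own
    class of level \<open>Suc m\<close>, which forces equal indices.\<close>
  moreover have "\<not> (\<forall>N. \<forall>\<^sub>F i in sequentially. split Z N w (z i))" for w
  proof
    assume "\<forall>N. \<forall>\<^sub>F i in sequentially. split Z N w (z i)"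
    then have "\<forall>\<^sub>F i in sequentially. split Z (Suc (depth Z m w)) w (z i)" by blast
    then have "\<forall>\<^sub>F i in sequentially. E (Suc m) w (z i)"
      by (rule eventually_mono) (rule E_if_split)
    then obtain K where K: "\<And>i. K \<le> i \<Longrightarrow> E (Suc m) w (z i)"
      unfolding eventually_sequentially by blast
    have "index Z m (z K) = index Z m (z (Suc K))"
      using index_cong[OF K, of K] index_cong[OF K, of "Suc K"] by (metis le_SucI order_refl)
    then show False using z(2) by simp
  qed
  ultimately show ?thesis
    using zF unfolding S.tcomplete_def by blast
qed

text \<open>The negated claim is applied to two metrics with the same \<open>r\<close>. For the
  given tower it yields a complete piece that is not sigma-locally compact; for the tower split
  along a kernel \<open>Z\<close> of this piece it yields a cover that cannot exist.\<close>

lemma exists_UMet_bd_not_fsigma_in: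
  assumes R: "range r \<subseteq> R" "0 \<in> R" and not: "\<not> sigma_locally_compact_space X"
  shows "\<exists>u\<in>UMet_bd X R.
    \<not> fsigma_in (mtopology_of (completion_metric u)) (completion_embed u ` topspace X)"
proof (rule ccontr)
  assume "\<not> ?thesis"
  then have fs: "fsigma_in (mtopology_of (completion_metric u)) (completion_embed u ` topspace X)"
    if "u \<in> UMet_bd X R" for u using that by blast
  obtain F :: "nat \<Rightarrow> 'a set" where F: "(\<Union>k. F k) = topspace X" "\<And>k. tcomplete (F k)"
    using fsigma_in_completion_imp_tcomplete[OF fs[OF tmetric_in_UMet_bd[OF R]]] by metis
  obtain k where k: "\<not> sigma_locally_compact_in X (F k)"
    using not sigma_locally_compact_in_imp_space sigma_locally_compact_in_UN F(1) by metis
  obtain Z where Z: "tcomplete Z" "Z \<noteq> {}" "\<And>n x. x \<in> Z \<Longrightarrow> \<not> compactin X (Z \<inter> cls n x)"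
    using noncompact_kernel[OF F(2) k] by blast
  interpret S: clopen_tower X "split Z" r by (rule clopen_tower_split)
  obtain G :: "nat \<Rightarrow> 'a set" where G: "(\<Union>k. G k) = topspace X"
    "\<And>k. closedin X (G k)" "\<And>k. S.tcomplete (G k)"
    using S.fsigma_in_completion_imp_tcomplete[OF fs[OF S.tmetric_in_UMet_bd[OF R]]] by metis
  show False using no_tcomplete_split_cover[OF Z G(1,2)] G(3) by blast
qed

end


section \<open>The characterization\<close>

text \<open>The balls of \<open>m\<close> supply the partitions, while the new distances are the
  values \<open>r n\<close>, chosen independently of the radii. This turns an arbitrary ultrametric
  into a bounded one with values in \<open>R\<close>.\<close>

lemma clopen_tower_ultrametric:
  assumes u: "ultrametric m" and r: "\<And>n. 0 < r n" "\<And>n. r (Suc n) < r n" "r \<longlonglongrightarrow> 0"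
  shows "clopen_tower (mtopology_of m)
    (\<lambda>n x y. x \<in> mspace m \<and> y \<in> mspace m \<and> mdist m x y < inverse (Suc n)) r"
proof -
  interpret M: Metric_space "mspace m" "mdist m" by simp
  have ball: "{y. x \<in> mspace m \<and> y \<in> mspace m \<and> mdist m x y < e} = M.mball x e" for x e
    by auto
  show ?thesis
  proof
    fix n x y z
    assume "x \<in> mspace m \<and> y \<in> mspace m \<and> mdist m x y < inverse (Suc n)"
      "y \<in> mspace m \<and> z \<in> mspace m \<and> mdist m y z < inverse (Suc n)"
    then show "x \<in> mspace m \<and> z \<in> mspace m \<and> mdist m x z < inverse (Suc n)"
      using u unfolding ultrametric_def by (meson le_less_trans max_less_iff_conj)
  next
    fix n x y
    assume *: "x \<in> mspace m \<and> y \<in> mspace m \<and> mdist m x y < inverse (Suc (Suc n))"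
    have "inverse (Suc (Suc n)) \<le> inverse (real (Suc n))"
      by (rule le_imp_inverse_le) auto
    with * show "x \<in> mspace m \<and> y \<in> mspace m \<and> mdist m x y < inverse (Suc n)"
      by (meson less_le_trans)
  next
    show "openin (mtopology_of m) {y. x \<in> mspace m \<and> y \<in> mspace m \<and> mdist m x y < inverse (Suc n)}"
      for n x unfolding ball mtopology_of_def by simp
  next
    fix U x assume "openin (mtopology_of m) U" "x \<in> U"
    then obtain e where e: "e > 0" "M.mball x e \<subseteq> U"
      unfolding mtopology_of_def M.openin_mtopology by blast
    obtain n where "inverse (Suc n) < e" using reals_Archimedean[OF e(1)] by blast
    then have "M.mball x (inverse (Suc n)) \<subseteq> U"
      using e(2) M.mball_subset_concentric[of "inverse (Suc n)" e x] by auto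
    then show "\<exists>n. {y. x \<in> mspace m \<and> y \<in> mspace m \<and> mdist m x y < inverse (Suc n)} \<subseteq> U"
      unfolding ball by blast
  next
    fix x y assume x: "x \<in> topspace (mtopology_of m)"
      and *: "\<And>n. x \<in> mspace m \<and> y \<in> mspace m \<and> mdist m x y < inverse (Suc n)"
    have "\<not> 0 < mdist m x y"
      using * reals_Archimedean by (metis less_asym)
    then show "x = y" using *[of 0] by (metis M.mdist_pos_less)
  qed (use r in \<open>auto simp: mdist_commute\<close>)
qed

lemma characteristic_decreasing_sequence:
  assumes "range_set R" "characteristic R"
  obtains r :: "nat \<Rightarrow> real" where "\<And>n. r n \<in> R" "\<And>n. 0 < r n" "\<And>n. r (Suc n) < r n" "r \<longlonglongrightarrow> 0"
proof -
  have small: "\<exists>x\<in>R. 0 < x \<and> x < e" if "e > 0" for e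
  proof -
    have "\<exists>x\<in>R - {0}. x < e"
      using assms(2) that cInf_lessD[of "R - {0}" e] by (simp add: characteristic_def)
    then show ?thesis using assms(1) by (force simp: range_set_def)
  qed
  \<comment> \<open>The bound \<open>inverse (Suc n)\<close> is carried along in the dependent
    choice to force the limit \<open>0\<close>.\<close>
  have "\<exists>r. \<forall>n. (r n \<in> R \<and> 0 < r n \<and> r n < inverse (Suc n)) \<and> r (Suc n) < r n"
  proof (rule dependent_nat_choice)
    show "\<exists>x. x \<in> R \<and> 0 < x \<and> x < inverse (real (Suc 0))" using small[of 1] by auto
    fix x n assume "x \<in> R \<and> 0 < x \<and> x < inverse (real (Suc n))"
    then show "\<exists>y. (y \<in> R \<and> 0 < y \<and> y < inverse (real (Suc (Suc n)))) \<and> y < x"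
      using small[of "min x (inverse (real (Suc (Suc n))))"] by auto
  qed
  then obtain r where r: "\<And>n. r n \<in> R" "\<And>n. 0 < r n" "\<And>n. r n < inverse (Suc n)" "\<And>n. r (Suc n) < r n"
    by blast
  have "r \<longlonglongrightarrow> 0"
    by (rule tendsto_sandwich[OF _ _ tendsto_const LIMSEQ_inverse_real_of_nat])
      (use r(2,3) in \<open>auto intro!: always_eventually less_imp_le\<close>)
  then show thesis using that r by blast
qed

theorem theorem4p2:
  fixes R :: "real set" and X :: "'a topology"
  assumes "range_set R" and "characteristic R"
    and "ultrametrizable_space X"
  shows "(sigma_locally_compact_space X \<longleftrightarrow>
            (\<forall>u\<in>UMet_bd X R.
               fsigma_in (mtopology_of (completion_metric u)) (completion_embed u ` topspace X)))
       \<and> (\<not> sigma_locally_compact_space X \<longrightarrow>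
            (\<exists>u\<in>UMet_bd X R.
               \<not> fsigma_in (mtopology_of (completion_metric u)) (completion_embed u ` topspace X)))"
proof -
  have 1: "fsigma_in (mtopology_of (completion_metric u)) (completion_embed u ` topspace X)"
    if "sigma_locally_compact_space X" "u \<in> UMet_bd X R" for u
    using sigma_locally_compact_space_imp_fsigma_in_completion[of u] that
    by (auto simp: UMet_bd_def)
  have 2: "\<exists>u\<in>UMet_bd X R.
      \<not> fsigma_in (mtopology_of (completion_metric u)) (completion_embed u ` topspace X)"
    if not: "\<not> sigma_locally_compact_space X"
  proof -
    obtain m where m: "ultrametric m" "mtopology_of m = X"
      using assms(3) unfolding ultrametrizable_space_def by blast
    obtain r :: "nat \<Rightarrow> real" where r: "\<And>n. r n \<in> R" "\<And>n. 0 < r n" "\<And>n. r (Suc n) < r n" "r \<longlonglongrightarrow> 0"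
      using characteristic_decreasing_sequence[OF assms(1,2)] by metis
    have "0 \<in> R" "range r \<subseteq> R" using assms(1) r(1) by (auto simp: range_set_def)
    then show ?thesis
      using clopen_tower.exists_UMet_bd_not_fsigma_in[OF clopen_tower_ultrametric[OF m(1) r(2-4)]]
        not m(2) by metis
  qed
  show ?thesis using 1 2 by blast
qed

end
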